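(* Let $\mathcal{A}$ be an arborescence and let $\bot$ be the minimal element of $\mathcal{A}$. Then $\#\operatorname{Tr}(\mathcal{A})=b(\bot,0)$.
   Context: $\mathbb{N}$ contains $0$. Arborescence: a finite poset $\mathcal{A}$ whose Hasse diagram (the graph of covering relations) is a rooted tree whose root is the unique minimal element $\bot$, equipped with the rank function $\rho\colon\mathcal{A}\to\mathbb{N}$ sending $x$ to the number of edges in the unique path in the Hasse diagram from $\bot$ to $x$. Transfer system: for a finite poset $(\mathcal{P},\leq)$, a transfer system on $\mathcal{P}$ is a reflexive and transitive relation $R$ on $\mathcal{P}$ such that (1) $x\,R\,y$ implies $x\leq y$; and (2) for all $x,y,z\in\mathcal{P}$, if $x\,R\,z$ and $y\leq z$, then $m\,R\,y$ for every maximal element $m$ of $\{p\in \mathcal{P} : p\leq x \text{ and } p\leq y\}$. $\operatorname{Tr}(\mathcal{P})$ is the set of transfer systems on $\mathcal{P}$. For $x\in\mathcal{A}$ let $x^{\uparrow}=\{y\in\mathcal{A}\mid x\leq y\}$. For $n\in\mathbb{N}$ let $B(x,n)$ be the set of order-preserving functions $\sigma\colon x^{\uparrow}\to\mathbb{N}$ such that $\sigma(y)\leq\rho(y)$ for all $y\in x^{\uparrow}$ and $\sigma(x)\geq n$. Let $b(x,n)$ be the cardinality of $B(x,n)$. *)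

theory Defs
  imports Main "HOL-Library.FuncSet" "Graph_Theory.Pair_Digraph"
begin

(* A poset is a carrier A with a relation r such that partial_order_on A r,
   where (x, y) \<in> r means x \<le> y. *)

definition maximal_elements :: "'a rel \<Rightarrow> 'a set \<Rightarrow> 'a set" where
  "maximal_elements r S = {m \<in> S. \<forall>p\<in>S. (m, p) \<in> r \<longrightarrow> p = m}"

definition minimal_elements :: "'a rel \<Rightarrow> 'a set \<Rightarrow> 'a set" where
  "minimal_elements r S = {m \<in> S. \<forall>p\<in>S. (p, m) \<in> r \<longrightarrow> p = m}"

definition covering_relation :: "'a set \<Rightarrow> 'a rel \<Rightarrow> 'a rel" where
  "covering_relation A r =
     {(x, y) \<in> r. x \<noteq> y \<and> \<not> (\<exists>z\<in>A. z \<noteq> x \<and> z \<noteq> y \<and> (x, z) \<in> r \<and> (z, y) \<in> r)}"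

(* As in the graph theory library, an undirected edge is a pair of opposite arcs. *)
definition hasse_diagram :: "'a set \<Rightarrow> 'a rel \<Rightarrow> 'a pair_pre_digraph" where
  "hasse_diagram A r =
     \<lparr> pverts = A, parcs = covering_relation A r \<union> (covering_relation A r)\<inverse> \<rparr>"

(* Digraph_Component.tree is unsuitable here: it forbids directed cycles only, and so holds for
   every connected acyclic orientation and fails for every symmetric digraph with an edge.
   The walks of the library are lists of arcs; apath requires distinct vertices. *)
definition undirected_tree :: "'a pair_pre_digraph \<Rightarrow> bool" where
  "undirected_tree G \<longleftrightarrow> pair_graph G \<and> pverts G \<noteq> {} \<and>
     (\<forall>u\<in>pverts G. \<forall>v\<in>pverts G. \<exists>!p. pre_digraph.apath (with_proj G) u p v)"

definition arborescence :: "'a set \<Rightarrow> 'a rel \<Rightarrow> 'a \<Rightarrow> bool" where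
  "arborescence A r btm \<longleftrightarrow>
     finite A \<and> partial_order_on A r \<and>
     undirected_tree (hasse_diagram A r) \<and> minimal_elements r A = {btm}"

definition arb_rank :: "'a set \<Rightarrow> 'a rel \<Rightarrow> 'a \<Rightarrow> 'a \<Rightarrow> nat" where
  "arb_rank A r btm x =
     length (THE p. pre_digraph.apath (with_proj (hasse_diagram A r)) btm p x)"

definition transfer_system :: "'a set \<Rightarrow> 'a rel \<Rightarrow> 'a rel \<Rightarrow> bool" where
  "transfer_system P r R \<longleftrightarrow>
     R \<subseteq> P \<times> P \<and> refl_on P R \<and> trans R \<and>
     (\<forall>x y. (x, y) \<in> R \<longrightarrow> (x, y) \<in> r) \<and>
     (\<forall>x\<in>P. \<forall>y\<in>P. \<forall>z\<in>P. (x, z) \<in> R \<longrightarrow> (y, z) \<in> r \<longrightarrow>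
        (\<forall>m \<in> maximal_elements r {p \<in> P. (p, x) \<in> r \<and> (p, y) \<in> r}. (m, y) \<in> R))"

definition Tr :: "'a set \<Rightarrow> 'a rel \<Rightarrow> 'a rel set" where
  "Tr P r = {R. transfer_system P r R}"

definition upset :: "'a set \<Rightarrow> 'a rel \<Rightarrow> 'a \<Rightarrow> 'a set" where
  "upset A r x = {y \<in> A. (x, y) \<in> r}"

(* Functions on the up-set of x are represented by the extensional ones, so that each
   of them is counted once. *)
definition B_set :: "'a set \<Rightarrow> 'a rel \<Rightarrow> 'a \<Rightarrow> 'a \<Rightarrow> nat \<Rightarrow> ('a \<Rightarrow> nat) set" where
  "B_set A r btm x n =
     {\<sigma> \<in> upset A r x \<rightarrow>\<^sub>E (UNIV :: nat set).
        monotone_on (upset A r x) (\<lambda>y z. (y, z) \<in> r) (\<le>) \<sigma> \<and>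
        (\<forall>y \<in> upset A r x. \<sigma> y \<le> arb_rank A r btm y) \<and>
        \<sigma> x \<ge> n}"

definition b_num :: "'a set \<Rightarrow> 'a rel \<Rightarrow> 'a \<Rightarrow> 'a \<Rightarrow> nat \<Rightarrow> nat" where
  "b_num A r btm x n = card (B_set A r btm x n)"

end

theory Submission
  imports Defs
begin

text \<open>
  The elements below a given one form a chain, so a transfer system is a partial order \<open>R\<close>
  inside \<open>\<le>\<close> such that \<open>x R z\<close> and \<open>x \<le> y \<le> z\<close> imply \<open>x R y\<close>. Let \<open>d(y)\<close> be the number of
  \<open>x \<noteq> y\<close> with \<open>x R y\<close>. When \<open>z\<close> covers \<open>y\<close>, the elements strictly \<open>R\<close>-below \<open>z\<close> are an
  initial segment of those \<open>R\<close>-below \<open>y\<close>; this amounts to \<open>d(z) \<le> d(y) + 1\<close>, that is, to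
  \<open>\<rho> - d\<close> being order-preserving. Conversely \<open>d\<close> determines \<open>R\<close>: an element \<open>x\<close> stays in the
  initial segments up to \<open>y\<close> exactly if \<open>d(x) < d(z)\<close> for all \<open>z\<close> with \<open>x < z \<le> y\<close>. So
  \<open>R \<mapsto> \<rho> - d\<close> is a bijection from the transfer systems to \<open>B(\<bottom>, 0)\<close>.
\<close>

section \<open>Finite orders with a least element and chains below every element\<close>

definition strict_down :: "'a rel \<Rightarrow> 'a \<Rightarrow> 'a set" where
  "strict_down r y = {x. (x, y) \<in> r \<and> x \<noteq> y}"

text \<open>The purely order-theoretic content of an arborescence. The counting argument runs on
  these properties; paths in the Hasse diagram serve to establish them and to identify the rank with
  \<open>height\<close>.\<close>

locale tree_order =
  fixes A :: "'a set" and r :: "'a rel" and btm :: 'a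
  assumes finite_carrier: "finite A"
    and partial_order: "partial_order_on A r"
    and btm_in: "btm \<in> A"
    and btm_least: "x \<in> A \<Longrightarrow> (btm, x) \<in> r"
    and below_linear: "(x, z) \<in> r \<Longrightarrow> (y, z) \<in> r \<Longrightarrow> (x, y) \<in> r \<or> (y, x) \<in> r"
begin

lemma r_carrier: "(x, y) \<in> r \<Longrightarrow> x \<in> A \<and> y \<in> A"
  using partial_order by (auto simp: partial_order_on_def preorder_on_def refl_on_def)

lemma r_refl: "x \<in> A \<Longrightarrow> (x, x) \<in> r"
  using partial_order by (auto simp: partial_order_on_def preorder_on_def refl_on_def)

lemma r_trans: "(x, y) \<in> r \<Longrightarrow> (y, z) \<in> r \<Longrightarrow> (x, z) \<in> r"
  using partial_order by (auto simp: partial_order_on_def preorder_on_def dest: transD)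

lemma r_antisym: "(x, y) \<in> r \<Longrightarrow> (y, x) \<in> r \<Longrightarrow> x = y"
  using partial_order by (auto simp: partial_order_on_def dest: antisymD)

definition height :: "'a \<Rightarrow> nat" where
  "height y = card (strict_down r y)"

lemma finite_strict_down: "finite (strict_down r y)"
  by (rule finite_subset[OF _ finite_carrier]) (auto simp: strict_down_def dest: r_carrier)

lemma height_btm: "height btm = 0"
proof -
  have "strict_down r btm = {}"
    using btm_least r_antisym r_carrier by (auto simp: strict_down_def)
  then show ?thesis by (simp add: height_def)
qed

lemma height_strict_mono:
  assumes "(x, y) \<in> r" "x \<noteq> y"
  shows "height x < height y"
  unfolding height_def
proof (rule psubset_card_mono[OF finite_strict_down])
  have "x \<in> strict_down r y" "x \<notin> strict_down r x"
    using assms by (auto simp: strict_down_def)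
  moreover have "strict_down r x \<subseteq> strict_down r y"
    using assms by (auto simp: strict_down_def dest: r_trans r_antisym)
  ultimately show "strict_down r x \<subset> strict_down r y" by blast
qed

text \<open>Take \<open>z\<close> of least height among the elements above \<open>x\<close> and up
  to \<open>y\<close>. As the elements below \<open>y\<close> form a chain, whatever lies strictly
  below \<open>z\<close> is \<open>x\<close> or lies below \<open>x\<close>, so the height grows by
  exactly one.\<close>

lemma successor_towards:
  assumes "(x, y) \<in> r" "x \<noteq> y"
  obtains z where "(x, z) \<in> r" "x \<noteq> z" "(z, y) \<in> r" "height z = Suc (height x)"
proof -
  define I where "I = {z. (x, z) \<in> r \<and> x \<noteq> z \<and> (z, y) \<in> r}"
  have "y \<in> I" using assms by (auto simp: I_def intro: r_refl dest: r_carrier)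
  then obtain z where z: "z \<in> I" and least: "\<And>w. w \<in> I \<Longrightarrow> height z \<le> height w"
    using arg_min_natI[of "\<lambda>z. z \<in> I" y height] arg_min_nat_le[of "\<lambda>z. z \<in> I" _ height]
    by metis
  have "strict_down r z = insert x (strict_down r x)"
  proof (intro equalityI subsetI)
    fix w assume w: "w \<in> strict_down r z"
    then have "w \<notin> I"
      using least[of w] height_strict_mono[of w z] by (fastforce simp: strict_down_def)
    moreover have "(w, x) \<in> r \<or> (x, w) \<in> r" "(w, y) \<in> r"
      using w z below_linear r_trans unfolding I_def strict_down_def by blast+
    ultimately show "w \<in> insert x (strict_down r x)"
      by (auto simp: I_def strict_down_def)
  next
    fix w assume "w \<in> insert x (strict_down r x)"
    then show "w \<in> strict_down r z"
      using z by (auto simp: I_def strict_down_def dest: r_trans r_antisym)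
  qed
  then have "height z = Suc (height x)"
    using finite_strict_down[of x] by (simp add: height_def) (simp add: strict_down_def)
  with z show ?thesis by (intro that) (auto simp: I_def)
qed

text \<open>Below \<open>z\<close> the elements \<open>x\<close> and \<open>y\<close> are
  comparable, so the smaller one is their only maximal common lower bound. If it is
  \<open>y\<close>, the restriction axiom reduces to reflexivity; if it is \<open>x\<close>, it is
  the condition stated here.\<close>

lemma Tr_iff:
  "R \<in> Tr A r \<longleftrightarrow> refl_on A R \<and> trans R \<and> R \<subseteq> r \<and>
     (\<forall>x y z. (x, z) \<in> R \<longrightarrow> (x, y) \<in> r \<longrightarrow> (y, z) \<in> r \<longrightarrow> (x, y) \<in> R)"
  (is "?L \<longleftrightarrow> ?R")
proof
  assume L: ?L
  have "(x, y) \<in> R" if "(x, z) \<in> R" "(x, y) \<in> r" "(y, z) \<in> r" for x y z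
  proof -
    have "x \<in> maximal_elements r {p \<in> A. (p, x) \<in> r \<and> (p, y) \<in> r}"
      using that r_carrier r_refl r_antisym by (auto simp: maximal_elements_def)
    moreover have "x \<in> A" "y \<in> A" "z \<in> A" using that r_carrier by blast+
    ultimately show ?thesis using L that unfolding Tr_def transfer_system_def by blast
  qed
  then show ?R using L unfolding Tr_def transfer_system_def by blast
next
  assume R: ?R
  have "(m, y) \<in> R" if xz: "(x, z) \<in> R" and yz: "(y, z) \<in> r"
    and m: "m \<in> maximal_elements r {p \<in> A. (p, x) \<in> r \<and> (p, y) \<in> r}" for x y z m
  proof -
    have c: "x \<in> A" "y \<in> A" "(x, z) \<in> r" using xz yz R r_carrier by blast+
    consider "(x, y) \<in> r" | "(y, x) \<in> r" using below_linear[OF c(3) yz] by blast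
    then show ?thesis
    proof cases
      case 1
      then have "m = x" using m c r_refl by (auto simp: maximal_elements_def)
      then show ?thesis using R xz yz 1 by blast
    next
      case 2
      then have "m = y" using m c r_refl by (auto simp: maximal_elements_def)
      then show ?thesis using R c by (auto simp: refl_on_def)
    qed
  qed
  moreover have "R \<subseteq> A \<times> A" using R r_carrier by auto
  ultimately show ?L using R unfolding Tr_def transfer_system_def by blast
qed

section \<open>The correspondence between transfer systems and bounded monotone functions\<close>

definition height_bounded :: "('a \<Rightarrow> nat) set" where
  "height_bounded = {s \<in> A \<rightarrow>\<^sub>E UNIV.
     (\<forall>x y. (x, y) \<in> r \<longrightarrow> s x \<le> s y) \<and> (\<forall>y\<in>A. s y \<le> height y)}"

text \<open>For a transfer system this counts the elements strictly below \<open>y\<close> that are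
  not \<open>R\<close>-below it. Restricting to \<open>A\<close> makes the result extensional, as
  \<open>height_bounded\<close> demands.\<close>

definition defect :: "'a rel \<Rightarrow> 'a \<Rightarrow> nat" where
  "defect R = restrict (\<lambda>y. height y - card (strict_down R y)) A"

definition rel_of :: "('a \<Rightarrow> nat) \<Rightarrow> 'a rel" where
  "rel_of f = {(x, y) \<in> r. \<forall>z. (x, z) \<in> r \<longrightarrow> x \<noteq> z \<longrightarrow> (z, y) \<in> r \<longrightarrow> f x < f z}"

text \<open>This holds for arbitrary \<open>f\<close>. For transitivity, an intermediate
  \<open>z\<close> up to \<open>y\<close> is covered by the first pair; if \<open>z\<close> is above
  \<open>y\<close>, then \<open>f x \<le> f y < f z\<close>. Restriction only shrinks the interval
  over which \<open>z\<close> ranges.\<close>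

lemma rel_of_in_Tr: "rel_of f \<in> Tr A r"
  unfolding Tr_iff
proof (intro conjI allI impI)
  show "refl_on A (rel_of f)"
    by (auto simp: refl_on_def rel_of_def dest: r_carrier r_antisym intro: r_refl)
  show "rel_of f \<subseteq> r" by (auto simp: rel_of_def)
  show "trans (rel_of f)"
  proof (rule transI)
    fix x y w assume xy: "(x, y) \<in> rel_of f" and yw: "(y, w) \<in> rel_of f"
    have "f x < f z" if z: "(x, z) \<in> r" "x \<noteq> z" "(z, w) \<in> r" for z
    proof (cases "(z, y) \<in> r")
      case True
      then show ?thesis using xy z by (auto simp: rel_of_def)
    next
      case False
      have yx: "(x, y) \<in> r" "(y, w) \<in> r" using xy yw by (auto simp: rel_of_def)
      with False z below_linear have yz: "(y, z) \<in> r" by blast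
      moreover have "y \<noteq> z" using False yz r_carrier r_refl by blast
      ultimately have "f y < f z" using yw z by (auto simp: rel_of_def)
      moreover have "f x \<le> f y"
      proof (cases "x = y")
        case False
        then have "f x < f y" using xy yx r_carrier r_refl by (auto simp: rel_of_def)
        then show ?thesis by simp
      qed simp
      ultimately show ?thesis by simp
    qed
    then show "(x, w) \<in> rel_of f" using xy yw r_trans by (auto simp: rel_of_def)
  qed
  fix x y z assume "(x, z) \<in> rel_of f" "(x, y) \<in> r" "(y, z) \<in> r"
  then show "(x, y) \<in> rel_of f" by (auto simp: rel_of_def dest: r_trans)
qed

lemma strict_down_Tr:
  assumes "R \<in> Tr A r"
  shows "strict_down R y \<subseteq> strict_down r y"
  using assms by (auto simp: strict_down_def Tr_iff)

lemma finite_strict_down_Tr: "R \<in> Tr A r \<Longrightarrow> finite (strict_down R y)"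
  using strict_down_Tr finite_strict_down finite_subset by metis

lemma card_strict_down_Tr_le_height:
  "R \<in> Tr A r \<Longrightarrow> card (strict_down R y) \<le> height y"
  unfolding height_def by (intro card_mono finite_strict_down strict_down_Tr)

text \<open>Elements strictly \<open>R\<close>-below \<open>y\<close> that lie strictly below
  \<open>x\<close> are \<open>R\<close>-below \<open>x\<close> by restriction; the others are among
  the \<open>height y - height x\<close> elements gained between \<open>x\<close> and
  \<open>y\<close>. The additive form avoids truncated subtraction.\<close>

lemma card_strict_down_Tr_growth:
  assumes R: "R \<in> Tr A r" and xy: "(x, y) \<in> r"
  shows "card (strict_down R y) + height x \<le> card (strict_down R x) + height y"
proof -
  have sub: "strict_down r x \<subseteq> strict_down r y"
    using xy by (auto simp: strict_down_def dest: r_trans r_antisym)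
  have "strict_down R y \<subseteq> strict_down R x \<union> (strict_down r y - strict_down r x)"
    using R xy unfolding strict_down_def Tr_iff by blast
  then have "card (strict_down R y)
      \<le> card (strict_down R x \<union> (strict_down r y - strict_down r x))"
    by (intro card_mono finite_UnI finite_Diff finite_strict_down finite_strict_down_Tr R)
  also have "\<dots> \<le> card (strict_down R x) + card (strict_down r y - strict_down r x)"
    by (rule card_Un_le)
  also have "\<dots> = card (strict_down R x) + (height y - height x)"
    using sub by (simp add: height_def card_Diff_subset finite_strict_down)
  finally show ?thesis
    using card_mono[OF finite_strict_down sub] by (simp add: height_def)
qed

lemma defect_in_height_bounded:
  assumes R: "R \<in> Tr A r"
  shows "defect R \<in> height_bounded"
proof -
  have "defect R x \<le> defect R y" if "(x, y) \<in> r" for x y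
    using card_strict_down_Tr_growth[OF R that] r_carrier[OF that]
      card_strict_down_Tr_le_height[OF R, of x] card_strict_down_Tr_le_height[OF R, of y]
    by (simp add: defect_def)
  then show ?thesis
    by (auto simp: height_bounded_def defect_def)
qed

text \<open>The counts determine \<open>R\<close>. If \<open>x R y\<close>, then
  \<open>x R z\<close> for each \<open>z\<close> in between, so transitivity puts \<open>x\<close>
  and all elements \<open>R\<close>-below it strictly \<open>R\<close>-below \<open>z\<close>.
  Conversely, at the lowest \<open>z\<close> where \<open>x R z\<close> fails the count cannot
  exceed that at \<open>x\<close>.\<close>

lemma rel_of_card_strict_down:
  assumes R: "R \<in> Tr A r"
  shows "rel_of (\<lambda>y. card (strict_down R y)) = R"
proof (intro equalityI subrelI)
  fix x y assume xy: "(x, y) \<in> R"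
  have "card (strict_down R x) < card (strict_down R z)"
    if z: "(x, z) \<in> r" "x \<noteq> z" "(z, y) \<in> r" for z
  proof (rule psubset_card_mono[OF finite_strict_down_Tr[OF R]])
    have xz: "(x, z) \<in> R" using R xy z unfolding Tr_iff by blast
    have "strict_down R x \<subseteq> strict_down R z"
    proof
      fix w assume w: "w \<in> strict_down R x"
      then have "(w, z) \<in> R" using R xz unfolding Tr_iff strict_down_def by (blast dest: transD)
      moreover have "w \<noteq> z" using w z R r_antisym unfolding Tr_iff strict_down_def by blast
      ultimately show "w \<in> strict_down R z" by (simp add: strict_down_def)
    qed
    moreover have "x \<in> strict_down R z" "x \<notin> strict_down R x"
      using xz z by (auto simp: strict_down_def)
    ultimately show "strict_down R x \<subset> strict_down R z" by blast
  qed
  then show "(x, y) \<in> rel_of (\<lambda>y. card (strict_down R y))"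
    using xy R by (auto simp: rel_of_def Tr_iff)
next
  fix x y assume xy: "(x, y) \<in> rel_of (\<lambda>y. card (strict_down R y))"
  then have "(x, y) \<in> r" by (auto simp: rel_of_def)
  show "(x, y) \<in> R"
  proof (rule ccontr)
    assume "(x, y) \<notin> R"
    define N where "N = {z. (x, z) \<in> r \<and> (z, y) \<in> r \<and> (x, z) \<notin> R}"
    have "y \<in> N" using \<open>(x, y) \<in> r\<close> \<open>(x, y) \<notin> R\<close> r_carrier r_refl by (auto simp: N_def)
    then obtain z where z: "z \<in> N" and least: "\<And>w. w \<in> N \<Longrightarrow> height z \<le> height w"
      using arg_min_natI[of "\<lambda>z. z \<in> N" y height] arg_min_nat_le[of "\<lambda>z. z \<in> N" _ height]
      by metis
    have "strict_down R z \<subseteq> strict_down R x"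
    proof
      fix w assume w: "w \<in> strict_down R z"
      then have wz: "(w, z) \<in> R" "(w, z) \<in> r" "w \<noteq> z"
        using R by (auto simp: strict_down_def Tr_iff)
      have "w \<noteq> x" using wz z by (auto simp: N_def)
      \<comment> \<open>Otherwise \<open>w\<close> lies between \<open>x\<close> and
        \<open>z\<close>, so \<open>x R w\<close> by the choice of \<open>z\<close>, and
        transitivity would give \<open>x R z\<close>.\<close>
      have "\<not> (x, w) \<in> r"
      proof
        assume "(x, w) \<in> r"
        moreover have "w \<notin> N" using least[of w] height_strict_mono[of w z] wz by fastforce
        ultimately have "(x, w) \<in> R" using z wz r_trans unfolding N_def by blast
        then have "(x, z) \<in> R" using R wz unfolding Tr_iff by (blast dest: transD)
        then show False using z by (simp add: N_def)
      qed
      then have "(w, x) \<in> r" using below_linear wz z unfolding N_def by blast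
      then have "(w, x) \<in> R" using R wz z unfolding Tr_iff N_def by blast
      with \<open>w \<noteq> x\<close> show "w \<in> strict_down R x" by (simp add: strict_down_def)
    qed
    then have "card (strict_down R z) \<le> card (strict_down R x)"
      by (intro card_mono finite_strict_down_Tr R)
    moreover have "x \<noteq> z" using z R r_carrier by (auto simp: N_def Tr_iff refl_on_def)
    then have "card (strict_down R x) < card (strict_down R z)"
      using xy z by (auto simp: rel_of_def N_def)
    ultimately show False by simp
  qed
qed

text \<open>The function \<open>f\<close> maps the elements counted here bijectively onto the
  numbers below \<open>f y\<close>: it increases strictly along their chain, and every value is hit
  by a discrete intermediate value argument, since \<open>f\<close> starts at 0 in
  \<open>btm\<close> and rises by at most one per step.\<close>

lemma card_strict_down_rel_of:
  assumes s: "s \<in> height_bounded" and y: "y \<in> A"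
  shows "card (strict_down (rel_of (\<lambda>x. height x - s x)) y) = height y - s y"
proof -
  define f where "f = (\<lambda>x. height x - s x)"
  have "bij_betw f (strict_down (rel_of f) y) {..<f y}"
    unfolding bij_betw_def
  proof
    have mono: "f x < f w" if "x \<in> strict_down (rel_of f) y" "w \<in> strict_down (rel_of f) y"
      "(x, w) \<in> r" "x \<noteq> w" for x w
      using that unfolding strict_down_def rel_of_def by blast
    show "inj_on f (strict_down (rel_of f) y)"
    proof (rule inj_onI, rule ccontr)
      fix x w assume *: "x \<in> strict_down (rel_of f) y" "w \<in> strict_down (rel_of f) y"
        "f x = f w" "x \<noteq> w"
      then have "(x, w) \<in> r \<or> (w, x) \<in> r"
        using below_linear by (auto simp: strict_down_def rel_of_def)
      then show False using mono[of x w] mono[of w x] * by auto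
    qed
    show "f ` strict_down (rel_of f) y = {..<f y}"
    proof (intro equalityI subsetI)
      fix v assume "v \<in> f ` strict_down (rel_of f) y"
      then show "v \<in> {..<f y}" using y r_refl by (auto simp: strict_down_def rel_of_def)
    next
      fix v assume "v \<in> {..<f y}"
      then have v: "v < f y" by simp
      \<comment> \<open>The preimage of \<open>v\<close> is the highest element of \<open>X\<close>:
        beyond it \<open>f\<close> stays above \<open>v\<close>, which is exactly what membership in
        \<open>rel_of f\<close> requires.\<close>
      define X where "X = {x \<in> strict_down r y. f x \<le> v}"
      have "finite X" by (simp add: X_def finite_strict_down)
      moreover have "btm \<in> X"
        using v y btm_least height_btm by (auto simp: X_def strict_down_def f_def)
      ultimately obtain x where x: "x \<in> X" and greatest: "\<And>w. w \<in> X \<Longrightarrow> height w \<le> height x"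
        using Max_in[of "height ` X"] Max_ge[of "height ` X"]
        by (metis (no_types, lifting) empty_iff finite_imageI image_iff image_is_empty)
      have xy: "(x, y) \<in> r" "x \<noteq> y" "f x \<le> v" using x by (auto simp: X_def strict_down_def)
      have above: "v < f z" if "(x, z) \<in> r" "x \<noteq> z" "(z, y) \<in> r" for z
        using greatest[of z] height_strict_mono[of x z] that v
        by (cases "z = y") (auto simp: X_def strict_down_def not_le[symmetric])
      obtain z where z: "(x, z) \<in> r" "x \<noteq> z" "(z, y) \<in> r" "height z = Suc (height x)"
        using successor_towards xy by blast
      \<comment> \<open>The second bound guards the truncated subtraction in
        \<open>Suc (height x) - s x = Suc (height x - s x)\<close>.\<close>
      have "s x \<le> s z" "s x \<le> height x"
        using s z r_carrier by (auto simp: height_bounded_def)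
      then have "f z \<le> Suc (f x)" using z by (simp add: f_def)
      with above[OF z(1-3)] xy have "f x = v" by simp
      moreover have "x \<in> strict_down (rel_of f) y"
        using xy above \<open>f x = v\<close> by (auto simp: strict_down_def rel_of_def)
      ultimately show "v \<in> f ` strict_down (rel_of f) y" by blast
    qed
  qed
  then have "card (strict_down (rel_of f) y) = f y"
    by (auto dest: bij_betw_same_card)
  then show ?thesis by (simp only: f_def)
qed

lemma rel_of_cong: "(\<And>x. x \<in> A \<Longrightarrow> f x = g x) \<Longrightarrow> rel_of f = rel_of g"
  unfolding rel_of_def using r_carrier by (metis (no_types, lifting))

lemma card_Tr: "card (Tr A r) = card height_bounded"
proof (rule bij_betw_same_card)
  show "bij_betw defect (Tr A r) height_bounded"
  proof (rule bij_betw_byWitness[where f' = "\<lambda>s. rel_of (\<lambda>x. height x - s x)"])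
    show "\<forall>R\<in>Tr A r. rel_of (\<lambda>x. height x - defect R x) = R"
    proof
      fix R assume R: "R \<in> Tr A r"
      \<comment> \<open>Subtracting twice returns the count because it is at most the height; this
        identity is only available on \<open>A\<close>, hence the congruence rule.\<close>
      have "rel_of (\<lambda>x. height x - defect R x) = rel_of (\<lambda>x. card (strict_down R x))"
        using card_strict_down_Tr_le_height[OF R] by (intro rel_of_cong) (simp add: defect_def)
      then show "rel_of (\<lambda>x. height x - defect R x) = R"
        by (simp add: rel_of_card_strict_down R)
    qed
    show "\<forall>s\<in>height_bounded. defect (rel_of (\<lambda>x. height x - s x)) = s"
    proof (intro ballI ext)
      fix s y assume s: "s \<in> height_bounded"
      show "defect (rel_of (\<lambda>x. height x - s x)) y = s y"
      proof (cases "y \<in> A")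
        case True
        then have "s y \<le> height y" using s by (auto simp: height_bounded_def)
        with True show ?thesis by (simp add: defect_def card_strict_down_rel_of s)
      next
        case False
        then show ?thesis using s by (auto simp: defect_def height_bounded_def)
      qed
    qed
  qed (auto simp: defect_in_height_bounded rel_of_in_Tr)
qed

end

section \<open>Walks along covering relations\<close>

lemma pcas_append: "pcas x p y \<Longrightarrow> pcas y q z \<Longrightarrow> pcas x (p @ q) z"
  by (induction p arbitrary: x) auto

lemma pawalk_verts_nonempty: "pawalk_verts x p \<noteq> []"
  by (cases p) auto

lemma last_pawalk_verts: "pcas x p y \<Longrightarrow> last (pawalk_verts x p) = y"
  by (induction p arbitrary: x) (auto simp: pawalk_verts_nonempty)

lemma length_pawalk_verts: "length (pawalk_verts x p) = Suc (length p)"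
  by (induction p arbitrary: x) auto

lemma middle_in_pawalk_verts:
  "pcas x p y \<Longrightarrow> pcas y q z \<Longrightarrow> y \<in> set (pawalk_verts x (p @ q))"
proof (induction p arbitrary: x)
  case Nil
  then show ?case by (cases q) auto
qed auto

text \<open>Induction on the size of the interval from \<open>x\<close> to \<open>y\<close>: an
  element strictly between splits it into two intervals, each lacking one endpoint.\<close>

lemma covering_path_exists:
  assumes "finite A" "partial_order_on A r" "(x, y) \<in> r"
  shows "\<exists>p. set p \<subseteq> covering_relation A r \<and> pcas x p y"
  using assms(3)
proof (induction "card {z \<in> A. (x, z) \<in> r \<and> (z, y) \<in> r}" arbitrary: x y rule: less_induct)
  case less
  have carrier: "u \<in> A \<and> v \<in> A" if "(u, v) \<in> r" for u v
    using that assms(2) by (auto simp: partial_order_on_def preorder_on_def)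
  have refl: "(u, u) \<in> r" if "u \<in> A" for u
    using that assms(2) by (auto simp: partial_order_on_def preorder_on_def refl_on_def)
  have trans: "(u, w) \<in> r" if "(u, v) \<in> r" "(v, w) \<in> r" for u v w
    using that assms(2) by (auto simp: partial_order_on_def preorder_on_def dest: transD)
  have antisym: "u = v" if "(u, v) \<in> r" "(v, u) \<in> r" for u v
    using that assms(2) by (auto simp: partial_order_on_def dest: antisymD)
  consider "x = y" | "(x, y) \<in> covering_relation A r"
    | z where "z \<in> A" "z \<noteq> x" "z \<noteq> y" "(x, z) \<in> r" "(z, y) \<in> r"
    using less.prems by (auto simp: covering_relation_def)
  then show ?case
  proof cases
    case 1
    then show ?thesis by (intro exI[of _ "[]"]) simp
  next
    case 2
    then show ?thesis by (intro exI[of _ "[(x, y)]"]) simp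
  next
    case 3
    have ends: "x \<in> A" "y \<in> A" using carrier less.prems by blast+
    let ?I = "\<lambda>u v. {w \<in> A. (u, w) \<in> r \<and> (w, v) \<in> r}"
    have "card (?I x z) < card (?I x y)"
    proof (rule psubset_card_mono)
      have "y \<in> ?I x y" "y \<notin> ?I x z" using 3 ends less.prems refl antisym by blast+
      moreover have "?I x z \<subseteq> ?I x y" using 3 trans by blast
      ultimately show "?I x z \<subset> ?I x y" by blast
    qed (use assms(1) in simp)
    then obtain p where p: "set p \<subseteq> covering_relation A r" "pcas x p z"
      using less.hyps 3 by blast
    have "card (?I z y) < card (?I x y)"
    proof (rule psubset_card_mono)
      have "x \<in> ?I x y" "x \<notin> ?I z y" using 3 ends less.prems refl antisym by blast+
      moreover have "?I z y \<subseteq> ?I x y" using 3 trans by blast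
      ultimately show "?I z y \<subset> ?I x y" by blast
    qed (use assms(1) in simp)
    then obtain q where q: "set q \<subseteq> covering_relation A r" "pcas z q y"
      using less.hyps 3 by blast
    show ?thesis using p q pcas_append by (intro exI[of _ "p @ q"]) auto
  qed
qed

text \<open>Since \<open>sorted_wrt\<close> compares all pairs and not just neighbours, this yields
  both distinctness of the vertices and their pairwise comparability.\<close>

lemma covering_path_sorted:
  assumes "partial_order_on A r" "set p \<subseteq> covering_relation A r" "pcas x p y"
  shows "sorted_wrt (\<lambda>u v. (u, v) \<in> r \<and> u \<noteq> v) (pawalk_verts x p)"
  using assms(2,3)
proof (induction p arbitrary: x)
  case Nil
  then show ?case by simp
next
  case (Cons e p)
  obtain z where e: "e = (x, z)" and xz: "(x, z) \<in> r" "x \<noteq> z"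
    using Cons.prems by (cases e) (auto simp: covering_relation_def)
  let ?vs = "pawalk_verts z p"
  have sorted: "sorted_wrt (\<lambda>u v. (u, v) \<in> r \<and> u \<noteq> v) ?vs"
    using Cons e by auto
  have "\<exists>vs. ?vs = z # vs"
    using Cons.prems e by (cases p) auto
  then have "v = z \<or> (z, v) \<in> r \<and> z \<noteq> v" if "v \<in> set ?vs" for v
    using that sorted by auto
  moreover have "(x, v) \<in> r \<and> x \<noteq> v" if "(z, v) \<in> r" for v
    using that xz assms(1) unfolding partial_order_on_def preorder_on_def
    by (blast dest: transD antisymD)
  ultimately have "(x, v) \<in> r \<and> x \<noteq> v" if "v \<in> set ?vs" for v
    using that xz by blast
  then show ?case using e sorted by auto
qed

lemma sorted_wrt_neq_distinct: "sorted_wrt (\<lambda>u v. P u v \<and> u \<noteq> v) vs \<Longrightarrow> distinct vs"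
  by (induction vs) auto

lemma sorted_wrt_last: "sorted_wrt P vs \<Longrightarrow> v \<in> set vs \<Longrightarrow> v = last vs \<or> P v (last vs)"
  by (induction vs) auto

lemma sorted_wrt_comparable:
  "sorted_wrt P vs \<Longrightarrow> u \<in> set vs \<Longrightarrow> v \<in> set vs \<Longrightarrow> u = v \<or> P u v \<or> P v u"
  by (induction vs) auto

section \<open>Arborescences as tree orders\<close>

lemma minimal_below:
  assumes "finite A" "partial_order_on A r" "x \<in> A"
  shows "\<exists>m \<in> minimal_elements r A. (m, x) \<in> r"
  using assms(3)
proof (induction "card {z \<in> A. (z, x) \<in> r}" arbitrary: x rule: less_induct)
  case less
  have refl: "(x, x) \<in> r"
    using less.prems assms(2) by (auto simp: partial_order_on_def preorder_on_def refl_on_def)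
  show ?case
  proof (cases "x \<in> minimal_elements r A")
    case False
    then obtain y where y: "y \<in> A" "(y, x) \<in> r" "y \<noteq> x"
      using less.prems by (auto simp: minimal_elements_def)
    have trans: "(u, x) \<in> r" if "(u, y) \<in> r" for u
      using that y assms(2) by (auto simp: partial_order_on_def preorder_on_def dest: transD)
    have "(x, y) \<notin> r" using y assms(2) by (auto simp: partial_order_on_def dest: antisymD)
    then have "card {z \<in> A. (z, y) \<in> r} < card {z \<in> A. (z, x) \<in> r}"
      using assms(1) less.prems refl trans by (intro psubset_card_mono) auto
    then show ?thesis using less.hyps y trans by blast
  qed (use refl in blast)
qed

text \<open>A saturated chain from the root to \<open>y\<close> can be routed through any prescribed element
  below \<open>y\<close>, so by uniqueness of paths all elements below \<open>y\<close> lie on a single path.\<close>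

lemma arborescence_path:
  assumes arb: "arborescence A r btm" and y: "y \<in> A"
  defines "p \<equiv> THE p. pre_digraph.apath (with_proj (hasse_diagram A r)) btm p y"
  shows "sorted_wrt (\<lambda>u v. (u, v) \<in> r \<and> u \<noteq> v) (pawalk_verts btm p)"
    and "set (pawalk_verts btm p) = {w. (w, y) \<in> r}"
proof -
  have fin: "finite A" and po: "partial_order_on A r" and min: "minimal_elements r A = {btm}"
    and tree: "undirected_tree (hasse_diagram A r)"
    using arb by (auto simp: arborescence_def)
  have btm: "btm \<in> A" using min by (auto simp: minimal_elements_def)
  have least: "(btm, x) \<in> r" if "x \<in> A" for x
    using minimal_below[OF fin po that] min by auto
  have refl: "(x, x) \<in> r" if "x \<in> A" for x
    using that po by (auto simp: partial_order_on_def preorder_on_def refl_on_def)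
  \<comment> \<open>An ascending walk repeats no vertex, so it is a path of the Hasse diagram and
    must be the unique one.\<close>
  have p_eq: "q = p" if "set q \<subseteq> covering_relation A r" "pcas btm q y" for q
  proof -
    have "sorted_wrt (\<lambda>u v. (u, v) \<in> r \<and> u \<noteq> v) (pawalk_verts btm q)"
      by (rule covering_path_sorted[OF po that])
    then have "distinct (pawalk_verts btm q)" by (rule sorted_wrt_neq_distinct)
    then have "pre_digraph.apath (with_proj (hasse_diagram A r)) btm q y"
      using that btm
      by (auto simp: pre_digraph.apath_def pre_digraph.awalk_def hasse_diagram_def
          cas_with_proj_eq awalk_verts_with_proj_eq)
    moreover have "\<exists>!q. pre_digraph.apath (with_proj (hasse_diagram A r)) btm q y"
      using tree btm y by (auto simp: undirected_tree_def hasse_diagram_def)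
    ultimately show ?thesis unfolding p_def by (metis the1_equality)
  qed
  obtain q where q: "set q \<subseteq> covering_relation A r" "pcas btm q y"
    using covering_path_exists[OF fin po least[OF y]] by blast
  show sorted: "sorted_wrt (\<lambda>u v. (u, v) \<in> r \<and> u \<noteq> v) (pawalk_verts btm p)"
    using covering_path_sorted[OF po q] p_eq[OF q] by simp
  show "set (pawalk_verts btm p) = {w. (w, y) \<in> r}"
  proof (intro equalityI subsetI CollectI)
    fix w assume "w \<in> set (pawalk_verts btm p)"
    then have "w = y \<or> (w, y) \<in> r"
      using sorted_wrt_last[OF sorted] last_pawalk_verts[OF q(2)] p_eq[OF q] by auto
    then show "(w, y) \<in> r" using refl y by blast
  next
    fix w assume "w \<in> {w. (w, y) \<in> r}"
    then have wy: "(w, y) \<in> r" by simp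
    then have "w \<in> A" using po by (auto simp: partial_order_on_def preorder_on_def)
    then obtain q1 where q1: "set q1 \<subseteq> covering_relation A r" "pcas btm q1 w"
      using covering_path_exists[OF fin po least] by blast
    obtain q2 where q2: "set q2 \<subseteq> covering_relation A r" "pcas w q2 y"
      using covering_path_exists[OF fin po wy] by blast
    have "q1 @ q2 = p" using q1 q2 by (intro p_eq pcas_append[of btm q1 w]) auto
    then show "w \<in> set (pawalk_verts btm p)"
      using middle_in_pawalk_verts[OF q1(2) q2(2)] by simp
  qed
qed

lemma tree_order_of_arborescence:
  assumes arb: "arborescence A r btm"
  shows "tree_order A r btm"
proof
  show "finite A" and po: "partial_order_on A r"
    using arb by (auto simp: arborescence_def)
  have min: "minimal_elements r A = {btm}" using arb by (auto simp: arborescence_def)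
  then show "btm \<in> A" by (auto simp: minimal_elements_def)
  show "(btm, x) \<in> r" if "x \<in> A" for x
    using minimal_below[OF \<open>finite A\<close> po that] min by auto
  fix x y z assume xz: "(x, z) \<in> r" and yz: "(y, z) \<in> r"
  then have carrier: "x \<in> A" "z \<in> A" using po by (auto simp: partial_order_on_def preorder_on_def)
  show "(x, y) \<in> r \<or> (y, x) \<in> r"
    using sorted_wrt_comparable[OF arborescence_path(1)[OF arb carrier(2)], of x y]
      arborescence_path(2)[OF arb carrier(2)] xz yz carrier po
    by (auto simp: partial_order_on_def preorder_on_def refl_on_def)
qed

text \<open>The path to \<open>y\<close> visits exactly \<open>y\<close> and the elements strictly
  below it, each once, and has one vertex more than it has edges.\<close>

lemma arb_rank_eq_height:
  assumes arb: "arborescence A r btm" and y: "y \<in> A"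
  shows "arb_rank A r btm y = tree_order.height r y"
proof -
  interpret tree_order A r btm by (rule tree_order_of_arborescence[OF arb])
  let ?p = "THE p. pre_digraph.apath (with_proj (hasse_diagram A r)) btm p y"
  note path = arborescence_path[OF arb y]
  have "{w. (w, y) \<in> r} = insert y (strict_down r y)"
    using y r_refl by (auto simp: strict_down_def)
  then have "card {w. (w, y) \<in> r} = Suc (height y)"
    using finite_strict_down[of y] by (simp add: height_def) (simp add: strict_down_def)
  moreover have "card (set (pawalk_verts btm ?p)) = Suc (length ?p)"
    using sorted_wrt_neq_distinct[OF path(1)] length_pawalk_verts by (simp add: distinct_card)
  ultimately show ?thesis using path(2) by (simp add: arb_rank_def)
qed

theorem mainTheorem2:
  fixes A :: "'a set" and r :: "'a rel" and btm :: 'a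
  assumes "arborescence A r btm"
  shows "card (Tr A r) = b_num A r btm btm 0"
proof -
  interpret tree_order A r btm by (rule tree_order_of_arborescence[OF assms])
  have "upset A r btm = A" using btm_least by (auto simp: upset_def)
  then have "B_set A r btm btm 0 = height_bounded"
    using arb_rank_eq_height[OF assms] r_carrier
    by (auto simp: B_set_def height_bounded_def monotone_on_def)
  then show ?thesis by (simp add: b_num_def card_Tr)
qed

end
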